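(* Let $r,s$ be nonzero real numbers with $r+s=1$, let $X$ and $Y$ be real vector spaces, and let $f : X \to Y$ be a function. If $r$ is a rational number, then $f$ satisfies $$f(rx+sy)+rs\,f(x-y)=r f(x)+s f(y)\quad\text{for all } x,y\in X$$ if and only if $f$ satisfies $$f(x+y)+f(x-y)=2f(x)+2f(y)\quad\text{for all } x,y\in X.$$ *)

theory Defs
  imports Complex_Main
begin

end

theory Submission
  imports Defs
begin

text \<open>
  Everything is read off from the polar form \<open>B x h = f (x + h) - f x - f h\<close>, or from its variant
  \<open>C x y = f (x + y) - f (x - y)\<close>, once this is known to be additive in each variable.

  Suppose \<open>f\<close> satisfies the weighted equation, the one involving \<open>r\<close> and \<open>s\<close>. Replacing \<open>(x, y)\<close> by \<open>(x + h, y + h)\<close> leaves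
  the term in \<open>x - y\<close> unchanged, so subtracting shows that the difference
  \<open>F x = f (x + h) - f x\<close> satisfies \<open>F (r x + s y) = r F x + s F y\<close>. Such an \<open>F\<close> is additive up to
  its value at \<open>0\<close>, hence \<open>B\<close> is biadditive. Biadditivity gives
  \<open>f (x + y) + f (x - y) = 2 f x + f y + f (- y)\<close> and also that \<open>g x = f x - f (- x)\<close> is
  additive. The weighted equation forces \<open>g (r x) = r\<^sup>2 g x\<close>, while additivity gives
  \<open>g (r x) = r g x\<close> because \<open>r\<close> is rational; as \<open>r\<close> is neither \<open>0\<close> nor \<open>1\<close>, \<open>g = 0\<close> and \<open>f\<close> is even.
  (For irrational \<open>r\<close> a nonzero additive \<open>g\<close> with \<open>g (r x) = r\<^sup>2 g x\<close> may exist, so this is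
  where rationality enters in this direction.)

  Conversely, for a quadratic \<open>f\<close> the classical parallelogram argument makes
  \<open>C\<close> biadditive and symmetric with \<open>C x x = 4 f x\<close>. Being additive, it commutes with
  rational scalars in each variable, and the weighted equation is an expansion of
  \<open>C (r x + s y) (r x + s y)\<close> using \<open>r + s = 1\<close>.
\<close>

lemma additive_scaleR_of_nat:
  fixes A :: "'a::real_vector \<Rightarrow> 'b::real_vector"
  assumes "additive A"
  shows "A (of_nat n *\<^sub>R x) = of_nat n *\<^sub>R A x"
proof -
  interpret additive A by fact
  show ?thesis by (induction n) (simp_all add: zero add scaleR_add_left)
qed

lemma additive_scaleR_of_int:
  fixes A :: "'a::real_vector \<Rightarrow> 'b::real_vector"
  assumes "additive A"
  shows "A (of_int k *\<^sub>R x) = of_int k *\<^sub>R A x"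
proof -
  interpret additive A by fact
  show ?thesis
    by (cases k rule: int_cases2) (simp_all add: minus additive_scaleR_of_nat[OF assms])
qed

lemma additive_scaleR_Rats:
  fixes A :: "'a::real_vector \<Rightarrow> 'b::real_vector"
  assumes "additive A" and "q \<in> \<rat>"
  shows "A (q *\<^sub>R x) = q *\<^sub>R A x"
proof -
  from \<open>q \<in> \<rat>\<close> obtain a b :: int where b: "b \<noteq> 0" and q: "q = of_int a / of_int b"
    by (elim Rats_cases') (metis less_irrefl)
  have "of_int b *\<^sub>R A (q *\<^sub>R x) = A (of_int b *\<^sub>R q *\<^sub>R x)"
    by (rule additive_scaleR_of_int[OF assms(1), symmetric])
  also have "\<dots> = A (of_int a *\<^sub>R x)"
    using b by (simp add: q)
  also have "\<dots> = of_int a *\<^sub>R A x"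
    by (rule additive_scaleR_of_int[OF assms(1)])
  also have "\<dots> = of_int b *\<^sub>R q *\<^sub>R A x"
    using b by (simp add: q)
  finally show ?thesis
    by (rule scaleR_left_imp_eq[rotated]) (use b in simp)
qed

text \<open>
  A function compatible with one fixed affine combination is additive up to a constant:
  the combination with one argument \<open>0\<close> lets the coefficients \<open>r\<close> and \<open>s\<close> be absorbed into the arguments.
\<close>
lemma additive_of_weighted_Jensen:
  fixes F :: "'a::real_vector \<Rightarrow> 'b::real_vector"
  assumes "r \<noteq> 0" "s \<noteq> 0" "r + s = 1"
    and F: "\<And>x y. F (r *\<^sub>R x + s *\<^sub>R y) = r *\<^sub>R F x + s *\<^sub>R F y"
  shows "additive (\<lambda>x. F x - F 0)"
proof
  fix u v :: 'a
  define G where "G x = F x - F 0" for x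
  have s: "s = 1 - r"
    using assms(3) by simp
  have G: "G (r *\<^sub>R x + s *\<^sub>R y) = r *\<^sub>R G x + s *\<^sub>R G y" for x y
    unfolding G_def F by (simp add: s algebra_simps)
  have G0: "G 0 = 0"
    by (simp add: G_def)
  have r: "r *\<^sub>R G (inverse r *\<^sub>R u) = G u"
    using G[of "inverse r *\<^sub>R u" 0] \<open>r \<noteq> 0\<close> by (simp add: G0)
  have "s *\<^sub>R G (inverse s *\<^sub>R v) = G v"
    using G[of 0 "inverse s *\<^sub>R v"] \<open>s \<noteq> 0\<close> by (simp add: G0)
  with r G[of "inverse r *\<^sub>R u" "inverse s *\<^sub>R v"] assms(1,2)
  have "G (u + v) = G u + G v"
    by simp
  then show "F (u + v) - F 0 = (F u - F 0) + (F v - F 0)"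
    by (simp add: G_def)
qed

lemma quadratic_of_weighted:
  fixes f :: "'a::real_vector \<Rightarrow> 'b::real_vector"
  assumes "r \<noteq> 0" "s \<noteq> 0" "r + s = 1" "r \<in> \<rat>"
    and W: "\<And>x y. f (r *\<^sub>R x + s *\<^sub>R y) + (r * s) *\<^sub>R f (x - y) = r *\<^sub>R f x + s *\<^sub>R f y"
  shows "f (x + y) + f (x - y) = 2 *\<^sub>R f x + 2 *\<^sub>R f y"
proof -
  have s: "s = 1 - r"
    using assms(3) by simp
  have f0: "f 0 = 0"
    using W[of 0 0] assms(1,2) by (simp add: s algebra_simps)
  have fr: "f (r *\<^sub>R x) = r\<^sup>2 *\<^sub>R f x" for x
  proof -
    have "f (r *\<^sub>R x) = r *\<^sub>R f x - (r * s) *\<^sub>R f x"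
      using W[of x 0] by (simp add: f0 eq_diff_eq)
    then show ?thesis
      by (simp add: s algebra_simps power2_eq_square)
  qed
  define B where "B x h = f (x + h) - f x - f h" for x h
  have B_left: "additive (\<lambda>x. B x h)" for h
  proof -
    define F where "F x = f (x + h) - f x" for x
    have "F (r *\<^sub>R x + s *\<^sub>R y) = r *\<^sub>R F x + s *\<^sub>R F y" for x y
    proof -
      have shift: "r *\<^sub>R (x + h) + s *\<^sub>R (y + h) = r *\<^sub>R x + s *\<^sub>R y + h"
        by (simp add: s algebra_simps)
      have eq_h: "f (r *\<^sub>R x + s *\<^sub>R y + h) = r *\<^sub>R f (x + h) + s *\<^sub>R f (y + h) - (r * s) *\<^sub>R f (x - y)"
        using W[of "x + h" "y + h"] by (simp add: shift eq_diff_eq)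
      have eq: "f (r *\<^sub>R x + s *\<^sub>R y) = r *\<^sub>R f x + s *\<^sub>R f y - (r * s) *\<^sub>R f (x - y)"
        using W[of x y] by (simp add: eq_diff_eq)
      show ?thesis
        unfolding F_def eq_h eq by (simp add: scaleR_diff_right)
    qed
    then have "additive (\<lambda>x. F x - F 0)"
      by (rule additive_of_weighted_Jensen[OF assms(1-3)])
    then show ?thesis
      by (simp add: F_def B_def f0)
  qed
  have B_sym: "B x h = B h x" for x h
    by (simp add: B_def add.commute)
  have B_minus_left: "B (- x) h = - B x h" for x h
    by (rule additive.minus[OF B_left])
  have B_minus_right: "B x (- h) = - B x h" for x h
    by (metis B_sym B_minus_left)
  define g where "g x = f x - f (- x)" for x
  have "additive g"
  proof
    fix x y
    have "g (x + y) - g x - g y = B x y - B (- x) (- y)"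
      by (simp add: g_def B_def algebra_simps)
    also have "\<dots> = 0"
      by (simp add: B_minus_left B_minus_right)
    finally show "g (x + y) = g x + g y"
      by (simp add: algebra_simps)
  qed
  have "g y = 0"
  proof -
    have "r *\<^sub>R g y = g (r *\<^sub>R y)"
      using additive_scaleR_Rats[OF \<open>additive g\<close> \<open>r \<in> \<rat>\<close>] by simp
    also have "\<dots> = r\<^sup>2 *\<^sub>R g y"
      using fr[of y] fr[of "- y"] by (simp add: g_def scaleR_diff_right)
    finally have "(r * s) *\<^sub>R g y = 0"
      by (simp add: s algebra_simps power2_eq_square)
    with assms(1,2) show ?thesis
      by simp
  qed
  then have even: "f (- y) = f y"
    by (simp add: g_def)
  have "f (x + y) + f (x - y) - 2 *\<^sub>R f x - f y - f (- y) = B x y + B x (- y)"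
    by (simp add: B_def scaleR_2 algebra_simps)
  also have "\<dots> = 0"
    by (simp add: B_minus_right)
  finally show ?thesis
    by (simp add: even scaleR_2 algebra_simps)
qed

lemma weighted_of_quadratic:
  fixes f :: "'a::real_vector \<Rightarrow> 'b::real_vector"
  assumes "r + s = 1" "r \<in> \<rat>"
    and Q: "\<And>x y. f (x + y) + f (x - y) = 2 *\<^sub>R f x + 2 *\<^sub>R f y"
  shows "f (r *\<^sub>R x + s *\<^sub>R y) + (r * s) *\<^sub>R f (x - y) = r *\<^sub>R f x + s *\<^sub>R f y"
proof -
  have s: "s = 1 - r"
    using assms(1) by simp
  have f0: "f 0 = 0"
  proof -
    have "f 0 + f 0 = 0"
      using Q[of 0 0] by (simp add: scaleR_2)
    then have "2 *\<^sub>R f 0 = 0"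
      by (simp only: scaleR_2)
    then show ?thesis
      by simp
  qed
  have even: "f (- x) = f x" for x
    using Q[of 0 x] by (simp add: f0 scaleR_2)
  define C where "C x y = f (x + y) - f (x - y)" for x y
  \<comment> \<open>The sums \<open>f (u \<plusminus> y) + f (v \<plusminus> y)\<close> are parallelogram sums sharing the diagonal \<open>u - v\<close>.\<close>
  have C_half: "2 *\<^sub>R (C u y + C v y) = C (u + v) (2 *\<^sub>R y)" for u v y
  proof -
    have "f (u + v + 2 *\<^sub>R y) + f (u - v) = 2 *\<^sub>R f (u + y) + 2 *\<^sub>R f (v + y)"
      using Q[of "u + y" "v + y"] by (simp add: scaleR_2 algebra_simps)
    moreover have "f (u + v - 2 *\<^sub>R y) + f (u - v) = 2 *\<^sub>R f (u - y) + 2 *\<^sub>R f (v - y)"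
      using Q[of "u - y" "v - y"] by (simp add: scaleR_2 algebra_simps)
    ultimately have "C (u + v) (2 *\<^sub>R y)
        = (2 *\<^sub>R f (u + y) + 2 *\<^sub>R f (v + y)) - (2 *\<^sub>R f (u - y) + 2 *\<^sub>R f (v - y))"
      unfolding C_def by (metis add_diff_cancel_right)
    then show ?thesis
      by (simp add: C_def algebra_simps)
  qed
  have C_double: "2 *\<^sub>R C u y = C u (2 *\<^sub>R y)" for u y
    using C_half[of u y 0] by (simp add: C_def even)
  have C_left: "additive (\<lambda>x. C x y)" for y
  proof
    fix u v
    have "2 *\<^sub>R C (u + v) y = 2 *\<^sub>R (C u y + C v y)"
      by (simp only: C_double C_half)
    then show "C (u + v) y = C u y + C v y"
      by (simp only: scaleR_cancel_left) simp
  qed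
  have C_sym: "C x y = C y x" for x y
    using even[of "x - y"] by (simp add: C_def add.commute)
  have "s \<in> \<rat>"
    using assms(2) by (simp add: s)
  have C_scale: "C (q *\<^sub>R x) y = q *\<^sub>R C x y" if "q \<in> \<rat>" for q x y
    using additive_scaleR_Rats[OF C_left that] .
  have C_comb: "C (r *\<^sub>R x + s *\<^sub>R y) z = r *\<^sub>R C x z + s *\<^sub>R C y z" for x y z
    using additive.add[OF C_left] C_scale assms(2) \<open>s \<in> \<rat>\<close> by simp
  have C_diff: "C (x - y) z = C x z - C y z" for x y z
    by (rule additive.diff[OF C_left])
  have C_diag: "C x x = 4 *\<^sub>R f x" for x
    using Q[of x x] by (simp add: C_def f0 flip: scaleR_add_left)
  let ?w = "r *\<^sub>R x + s *\<^sub>R y"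
  have "C ?w ?w = r *\<^sub>R C ?w x + s *\<^sub>R C ?w y"
    using C_comb[of x y ?w] by (simp add: C_sym)
  also have "\<dots> = (r * r) *\<^sub>R C x x + (r * s) *\<^sub>R C x y + (r * s) *\<^sub>R C x y + (s * s) *\<^sub>R C y y"
    by (simp add: C_comb C_sym[of y x] algebra_simps)
  finally have w: "C ?w ?w = \<dots>" .
  have d: "C (x - y) (x - y) = C x x - C x y - C x y + C y y"
  proof -
    have "C (x - y) (x - y) = C (x - y) x - C (x - y) y"
      unfolding C_diff[of x y "x - y"] by (simp only: C_sym[of x] C_sym[of y])
    then show ?thesis
      by (simp add: C_diff C_sym[of y x])
  qed
  have double: "(r * 2) *\<^sub>R z = r *\<^sub>R z + r *\<^sub>R z" for z :: 'b
    by (simp flip: scaleR_add_left)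
  have "C ?w ?w + (r * s) *\<^sub>R C (x - y) (x - y) = r *\<^sub>R C x x + s *\<^sub>R C y y"
    unfolding w d by (simp add: s algebra_simps double)
  then have "4 *\<^sub>R (f ?w + (r * s) *\<^sub>R f (x - y)) = 4 *\<^sub>R (r *\<^sub>R f x + s *\<^sub>R f y)"
    by (simp add: C_diag algebra_simps)
  then show ?thesis
    by (simp only: scaleR_cancel_left) simp
qed

theorem theorem2p3:
  fixes r s :: real
    and f :: "'a::real_vector \<Rightarrow> 'b::real_vector"
  assumes "r \<noteq> 0" and "s \<noteq> 0" and "r + s = 1" and "r \<in> \<rat>"
  shows "(\<forall>x y. f (r *\<^sub>R x + s *\<^sub>R y) + (r * s) *\<^sub>R f (x - y) = r *\<^sub>R f x + s *\<^sub>R f y)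
     \<longleftrightarrow> (\<forall>x y. f (x + y) + f (x - y) = 2 *\<^sub>R f x + 2 *\<^sub>R f y)"
  using quadratic_of_weighted[OF assms] weighted_of_quadratic[OF assms(3,4)] by blast

end
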